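(* Let $N\ge 1$, let $|\cdot|:\mathbb{Z}_N\to\mathbb{R}_{\ge 0}$ satisfy $|0|=0$ and $|k|=|-k|$ for all $k\in\mathbb{Z}_N$, and let $p_i(t)$ ($i\in\mathbb{Z}_N$, $t\ge 0$) be the coefficients in the decomposition $P_t=\sum_{i\in\mathbb{Z}_N}p_i(t)\,\sigma_i$ of the semigroup $P_t$ associated with $|\cdot|$. If there exists $\epsilon>0$ such that for all $i\in\mathbb{Z}_N$ one has $p_i(t)\ge 0$ for all $0\le t\le\epsilon$, then for every $j\in\mathbb{Z}_N$ one has $p_j(t)\ge 0$ for all $t\ge 0$.
   Context: Let $\mathcal{L}\mathbb{Z}_N$ be the complex group algebra of the cyclic group $\mathbb{Z}_N$ (written additively, identity $0$), with basis $\{|k\rangle : k\in\mathbb{Z}_N\}$ (ket notation for the group element basis). The semigroup $(P_t)_{t\ge 0}$ associated with $|\cdot|$ consists of the linear operators on $\mathcal{L}\mathbb{Z}_N$ defined by $P_t|k\rangle=e^{-t|k|}\,|k\rangle$ (here $|k|$ in the exponent is the value of the function $|\cdot|$ at $k$). For $i\in\mathbb{Z}_N$ the operator $\sigma_i$ is defined by $\sigma_i|k\rangle=q^{ik}|k\rangle$, where $q=\exp(2\pi i_0/N)$ and $i_0=\sqrt{-1}$. The $\sigma_i$ are mutually orthogonal with respect to $\langle a,b\rangle=\mathrm{Tr}(a^*b)$, and the coefficients $p_i(t)$ are the uniquely determined numbers with $P_t=\sum_{i\in\mathbb{Z}_N}p_i(t)\sigma_i$, i.e. $e^{-t|k|}=\sum_{i\in\mathbb{Z}_N}p_i(t)q^{ik}$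 for all $k\in\mathbb{Z}_N$. They are real because $|k|=|-k|$. *)

theory Defs
  imports
    "HOL-Analysis.Analysis"
    "HOL-Library.Poly_Mapping"
    "HOL-Library.Complex_Order"
    "Berlekamp_Zassenhaus.Finite_Field"
begin

text \<open>
  The cyclic group of order \<open>N = CARD('n)\<close> is the additive group of \<^typ>\<open>'n mod_ring\<close>.
  Its complex group algebra is \<^typ>\<open>'n mod_ring \<Rightarrow>\<^sub>0 complex\<close>: the multiplication that
  \<^theory>\<open>HOL-Library.Poly_Mapping\<close> puts on this type is convolution.
\<close>

type_synonym 'n group_algebra = "'n mod_ring \<Rightarrow>\<^sub>0 complex"

definition ket :: "'n::finite mod_ring \<Rightarrow> 'n group_algebra" where
  "ket k = Poly_Mapping.single k 1"

definition scale_ga :: "complex \<Rightarrow> 'n::finite group_algebra \<Rightarrow> 'n group_algebra" where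
  "scale_ga c x = Poly_Mapping.map ((*) c) x"

text \<open>The linear operator with prescribed values \<open>f k\<close> on the basis vectors \<open>ket k\<close>;
  see \<open>linear_extension_linear\<close>, \<open>linear_extension_ket\<close> and \<open>linear_extension_unique\<close> below.\<close>

definition linear_extension ::
  "('n::finite mod_ring \<Rightarrow> 'n group_algebra) \<Rightarrow> 'n group_algebra \<Rightarrow> 'n group_algebra" where
  "linear_extension f x = (\<Sum>k\<in>UNIV. scale_ga (Poly_Mapping.lookup x k) (f k))"

definition semigroup_op ::
  "('n::finite mod_ring \<Rightarrow> real) \<Rightarrow> real \<Rightarrow> 'n group_algebra \<Rightarrow> 'n group_algebra" where
  "semigroup_op len t = linear_extension (\<lambda>k. scale_ga (complex_of_real (exp (- t * len k))) (ket k))"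

text \<open>Since \<open>root_q\<close> is an \<open>N\<close>-th root of unity, \<open>q\<^sup>i\<^sup>k\<close> does not depend on the representatives
  of \<open>i\<close> and \<open>k\<close>; we take those in \<open>{0..<N}\<close>.\<close>

definition root_q :: "'n::finite itself \<Rightarrow> complex" where
  "root_q _ = exp (2 * of_real pi * \<i> / of_nat CARD('n))"

definition sigma_op :: "'n::finite mod_ring \<Rightarrow> 'n group_algebra \<Rightarrow> 'n group_algebra" where
  "sigma_op i = linear_extension
     (\<lambda>k. scale_ga (root_q TYPE('n) powi (to_int_mod_ring i * to_int_mod_ring k)) (ket k))"

lemma lookup_scale_ga [simp]:
  "Poly_Mapping.lookup (scale_ga c x) k = c * Poly_Mapping.lookup x k"
  by (simp add: scale_ga_def Poly_Mapping.map.rep_eq when_def)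

lemma vector_space_scale_ga:
  "vector_space (scale_ga :: complex \<Rightarrow> 'n::finite group_algebra \<Rightarrow> 'n group_algebra)"
  by unfold_locales (auto intro!: poly_mapping_eqI simp: lookup_add algebra_simps)

lemma lookup_ket: "Poly_Mapping.lookup (ket k) l = (if k = l then 1 else 0)"
  by (simp add: ket_def lookup_single when_def)

lemma linear_extension_linear:
  "Vector_Spaces.linear scale_ga scale_ga (linear_extension f)"
proof -
  interpret vector_space "scale_ga :: complex \<Rightarrow> 'a group_algebra \<Rightarrow> 'a group_algebra"
    by (rule vector_space_scale_ga)
  show ?thesis
    by unfold_locales
      (simp_all add: linear_extension_def lookup_add scale_left_distrib sum.distrib scale_sum_right)
qed

lemma linear_extension_ket: "linear_extension f (ket k) = f k"
proof -
  interpret vector_space "scale_ga :: complex \<Rightarrow> 'a group_algebra \<Rightarrow> 'a group_algebra"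
    by (rule vector_space_scale_ga)
  have "linear_extension f (ket k) = (\<Sum>l\<in>UNIV. if k = l then f l else 0)"
    unfolding linear_extension_def by (intro sum.cong) (auto simp: lookup_ket)
  then show ?thesis by simp
qed

lemma ket_expansion: "x = (\<Sum>k\<in>UNIV. scale_ga (Poly_Mapping.lookup x k) (ket k))"
proof (rule poly_mapping_eqI)
  fix l
  have "(\<Sum>k\<in>UNIV. Poly_Mapping.lookup x k * (if k = l then 1 else 0))
      = (\<Sum>k\<in>UNIV. if k = l then Poly_Mapping.lookup x k else 0)"
    by (intro sum.cong) auto
  then show "Poly_Mapping.lookup x l =
      Poly_Mapping.lookup (\<Sum>k\<in>UNIV. scale_ga (Poly_Mapping.lookup x k) (ket k)) l"
    by (simp add: lookup_sum lookup_ket)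
qed

lemma linear_extension_unique:
  assumes "Vector_Spaces.linear scale_ga scale_ga T" and "\<And>k. T (ket k) = f k"
  shows "T = linear_extension f"
proof
  fix x
  interpret Vector_Spaces.linear scale_ga scale_ga T by fact
  have "T x = T (\<Sum>k\<in>UNIV. scale_ga (Poly_Mapping.lookup x k) (ket k))"
    by (simp flip: ket_expansion)
  then show "T x = linear_extension f x"
    by (simp add: sum scale assms(2) linear_extension_def)
qed

end

theory Submission
  imports Defs
begin

text \<open>
  The operators \<^term>\<open>sigma_op i\<close> form a group, \<^term>\<open>sigma_op i \<circ> sigma_op j\<close> being
  \<^term>\<open>sigma_op (i + j)\<close>, and they are linearly independent. Composing the decompositions at the
  times \<open>s\<close> and \<open>t\<close> and using \<open>P\<^sub>s P\<^sub>t = P\<^bsub>s+t\<^esub>\<close> therefore gives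
  \[ p_j(s+t) = \sum_i p_i(s)\, p_{j-i}(t), \]
  so nonnegativity of all coefficients at \<open>s\<close> and at \<open>t\<close> passes to \<open>s + t\<close>. Hence it passes from
  \<open>[0, \<epsilon>]\<close> to \<open>[0, 2\<epsilon>]\<close>, and by repeated doubling to all of \<open>[0, \<infinity>)\<close>.

  Every operator involved is diagonal in the basis of kets, so the argument is carried out on the
  eigenvalues. The eigenvalues of \<^term>\<open>sigma_op i\<close> are the values of a character of the cyclic
  group; multiplicativity of characters (\<open>character_add_left\<close>) replaces the composition law,
  and Fourier inversion (\<open>fourier_coeff_unique\<close>) replaces linear independence.
\<close>

section \<open>Characters of the cyclic group\<close>

definition character :: "'n::finite mod_ring \<Rightarrow> 'n mod_ring \<Rightarrow> complex" where
  "character i k = root_q TYPE('n) powi (to_int_mod_ring i * to_int_mod_ring k)"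

lemma root_q_nonzero: "root_q TYPE('n::finite) \<noteq> 0"
  by (simp add: root_q_def)

lemma root_q_power_eq_1_iff: "root_q TYPE('n::finite) ^ j = 1 \<longleftrightarrow> CARD('n) dvd j"
proof -
  have "root_q TYPE('n) ^ j = exp (2 * of_real pi * \<i> * of_nat j / of_nat CARD('n))"
    by (simp add: root_q_def mult_ac flip: exp_of_nat_mult)
  moreover have "1 \<le> CARD('n)"
    by (simp add: Suc_leI)
  ultimately show ?thesis
    by (simp only: complex_root_unity_eq_1)
qed

lemma root_q_powi_mod:
  "root_q TYPE('n::finite) powi (m mod int CARD('n) * l) = root_q TYPE('n) powi (m * l)"
proof -
  let ?q = "root_q TYPE('n)"
  have "m * l = int CARD('n) * (m div int CARD('n) * l) + m mod int CARD('n) * l"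
    by (metis distrib_right mult.assoc mult_div_mod_eq)
  moreover have "?q powi (int CARD('n) * (m div int CARD('n) * l)) = 1"
    using root_q_power_eq_1_iff[where 'n = 'n and j = "CARD('n)"]
    by (simp only: power_int_mult power_int_of_nat power_int_1_left dvd_refl simp_thms)
  ultimately show ?thesis
    by (simp add: power_int_add root_q_nonzero)
qed

lemma character_commute: "character i k = character k i"
  by (simp add: character_def mult.commute)

lemma character_zero_left [simp]: "character 0 k = 1"
  by (simp add: character_def)

text \<open>Addition in the group is addition of representatives modulo \<open>N\<close>, and the reduction does not
  change the power of an \<open>N\<close>-th root of unity.\<close>

lemma character_add_left: "character (i + j) k = character i k * character j k"
proof -
  have "to_int_mod_ring (i + j) = (to_int_mod_ring i + to_int_mod_ring j) mod int CARD('a)"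
    by transfer simp
  then show ?thesis
    by (simp add: character_def root_q_powi_mod distrib_right power_int_add root_q_nonzero)
qed

lemma character_add_right: "character i (k + l) = character i k * character i l"
  by (metis character_add_left character_commute)

lemma character_nontrivial:
  fixes i :: "'n::finite mod_ring"
  assumes "i \<noteq> 0"
  shows "\<exists>k. character i k \<noteq> 1"
proof -
  let ?d = "nat (to_int_mod_ring i)"
  have d: "0 < to_int_mod_ring i" "to_int_mod_ring i < int CARD('n)"
    using assms by (transfer; force)+
  then have "to_int_mod_ring (of_int_mod_ring 1 :: 'n mod_ring) = 1"
    by (intro to_int_mod_ring_of_int_mod_ring) auto
  then have "character i (of_int_mod_ring 1) = root_q TYPE('n) ^ ?d"
    using d by (simp add: character_def power_int_def)
  moreover have "\<not> CARD('n) dvd ?d"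
    using d by (auto dest!: dvd_imp_le)
  ultimately show ?thesis
    by (metis root_q_power_eq_1_iff)
qed

text \<open>Translating the summation variable by an element on which the character is not \<open>1\<close> multiplies
  the sum by a factor different from \<open>1\<close>, so the sum vanishes.\<close>

lemma sum_character:
  fixes i :: "'n::finite mod_ring"
  shows "(\<Sum>k\<in>UNIV. character i k) = (if i = 0 then of_nat CARD('n) else 0)"
proof (cases "i = 0")
  case False
  then obtain l where l: "character i l \<noteq> 1"
    using character_nontrivial by blast
  have "(\<Sum>k\<in>UNIV. character i k) = (\<Sum>k\<in>UNIV. character i (k + l))"
    by (rule sum.reindex_bij_witness[of _ "\<lambda>k. k + l" "\<lambda>k. k - l"]) auto
  also have "\<dots> = (\<Sum>k\<in>UNIV. character i k) * character i l"
    by (simp add: character_add_right sum_distrib_right)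
  finally show ?thesis
    using l False by simp
qed simp

lemma fourier_inversion:
  fixes a :: "'n::finite mod_ring \<Rightarrow> complex"
  shows "(\<Sum>k\<in>UNIV. (\<Sum>i\<in>UNIV. a i * character i k) * character (- j) k) = of_nat CARD('n) * a j"
proof -
  have "(\<Sum>k\<in>UNIV. (\<Sum>i\<in>UNIV. a i * character i k) * character (- j) k)
      = (\<Sum>k\<in>UNIV. \<Sum>i\<in>UNIV. a i * character (i - j) k)"
    by (simp add: sum_distrib_right mult.assoc flip: character_add_left)
  also have "\<dots> = (\<Sum>i\<in>UNIV. a i * (\<Sum>k\<in>UNIV. character (i - j) k))"
    by (subst sum.swap) (simp add: sum_distrib_left)
  also have "\<dots> = (\<Sum>i\<in>UNIV. if i = j then a i * of_nat CARD('n) else 0)"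
    by (intro sum.cong) (auto simp: sum_character)
  finally show ?thesis
    by (simp add: mult.commute)
qed

lemma fourier_coeff_unique:
  fixes a b :: "'n::finite mod_ring \<Rightarrow> complex"
  assumes "\<And>k. (\<Sum>i\<in>UNIV. a i * character i k) = (\<Sum>i\<in>UNIV. b i * character i k)"
  shows "a j = b j"
proof -
  have "of_nat CARD('n) * a j = of_nat CARD('n) * b j"
    using fourier_inversion[of a j] fourier_inversion[of b j] assms by simp
  then show ?thesis
    by simp
qed

lemma fourier_convolution:
  fixes a b :: "'n::finite mod_ring \<Rightarrow> complex"
  shows "(\<Sum>j\<in>UNIV. (\<Sum>i\<in>UNIV. a i * b (j - i)) * character j k)
       = (\<Sum>i\<in>UNIV. a i * character i k) * (\<Sum>i\<in>UNIV. b i * character i k)"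
proof -
  have "(\<Sum>j\<in>UNIV. (\<Sum>i\<in>UNIV. a i * b (j - i)) * character j k)
      = (\<Sum>i\<in>UNIV. \<Sum>j\<in>UNIV. a i * b (j - i) * character j k)"
    by (subst sum.swap) (simp add: sum_distrib_right)
  also have "\<dots> = (\<Sum>i\<in>UNIV. \<Sum>j\<in>UNIV. a i * b j * character (j + i) k)"
  proof (rule sum.cong[OF refl])
    fix i :: "'n mod_ring"
    show "(\<Sum>j\<in>UNIV. a i * b (j - i) * character j k) = (\<Sum>j\<in>UNIV. a i * b j * character (j + i) k)"
      by (rule sum.reindex_bij_witness[of _ "\<lambda>j. j + i" "\<lambda>j. j - i"]) auto
  qed
  finally show ?thesis
    by (simp add: sum_product character_add_left mult_ac)
qed

section \<open>The coefficients of the semigroup\<close>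

lemma decomposition_eigenvalues:
  fixes len :: "'n::finite mod_ring \<Rightarrow> real"
  assumes "\<And>x. semigroup_op len t x = (\<Sum>i\<in>UNIV. scale_ga (c i) (sigma_op i x))"
  shows "complex_of_real (exp (- t * len k)) = (\<Sum>i\<in>UNIV. c i * character i k)"
proof -
  have "Poly_Mapping.lookup (semigroup_op len t (ket k)) k = complex_of_real (exp (- t * len k))"
    by (simp add: semigroup_op_def linear_extension_ket lookup_ket)
  moreover have "Poly_Mapping.lookup (sigma_op i (ket k)) k = character i k" for i
    by (simp add: sigma_op_def linear_extension_ket lookup_ket character_def)
  ultimately show ?thesis
    using assms[of "ket k"] by (simp add: lookup_sum)
qed

text \<open>Both sides are Fourier coefficients of the eigenvalue function at time \<open>s + t\<close>, which is the
  product of those at \<open>s\<close> and \<open>t\<close>; a product of functions has convolved coefficients.\<close>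

lemma coefficient_convolution:
  fixes len :: "'n::finite mod_ring \<Rightarrow> real"
  assumes decomposition:
      "\<And>t x. 0 \<le> t \<Longrightarrow> semigroup_op len t x = (\<Sum>i\<in>UNIV. scale_ga (p i t) (sigma_op i x))"
    and "0 \<le> s" "0 \<le> t"
  shows "p j (s + t) = (\<Sum>i\<in>UNIV. p i s * p (j - i) t)"
proof (rule fourier_coeff_unique)
  fix k
  have eig: "(\<Sum>i\<in>UNIV. p i u * character i k) = complex_of_real (exp (- u * len k))" if "0 \<le> u" for u
    using decomposition_eigenvalues[OF decomposition[OF that]] by simp
  have "exp (- (s + t) * len k) = exp (- s * len k) * exp (- t * len k)"
    by (simp add: algebra_simps flip: exp_add)
  then show "(\<Sum>j\<in>UNIV. p j (s + t) * character j k)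
      = (\<Sum>j\<in>UNIV. (\<Sum>i\<in>UNIV. p i s * p (j - i) t) * character j k)"
    using assms(2,3)
    by (simp only: fourier_convolution[of "\<lambda>i. p i s" "\<lambda>i. p i t"] eig of_real_mult add_nonneg_nonneg)
qed

theorem theorem2p1:
  fixes len :: "'n::finite mod_ring \<Rightarrow> real"
    and p :: "'n mod_ring \<Rightarrow> real \<Rightarrow> complex"
  assumes len_nonneg: "\<And>k. 0 \<le> len k"
    and len_zero: "len 0 = 0"
    and len_uminus: "\<And>k. len (- k) = len k"
    and decomposition:
      "\<And>t x. 0 \<le> t \<Longrightarrow> semigroup_op len t x = (\<Sum>i\<in>UNIV. scale_ga (p i t) (sigma_op i x))"
    and small_times:
      "\<exists>\<epsilon>>0. \<forall>i. \<forall>t. 0 \<le> t \<and> t \<le> \<epsilon> \<longrightarrow> 0 \<le> p i t"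
  shows "\<forall>j. \<forall>t\<ge>0. 0 \<le> p j t"
proof (intro allI impI)
  fix j and t :: real
  assume "0 \<le> t"
  obtain \<epsilon> where "\<epsilon> > 0" and small: "\<And>i t. 0 \<le> t \<Longrightarrow> t \<le> \<epsilon> \<Longrightarrow> 0 \<le> p i t"
    using small_times by blast
  have doubling: "0 \<le> p i u" if "0 \<le> u" "u \<le> 2 ^ n * \<epsilon>" for i u n
    using that
  proof (induction n arbitrary: i u)
    case 0
    then show ?case by (simp add: small)
  next
    case (Suc n)
    have "0 \<le> p i' (u / 2)" for i'
      using Suc.prems by (intro Suc.IH) simp_all
    then have "0 \<le> (\<Sum>i'\<in>UNIV. p i' (u / 2) * p (i - i') (u / 2))"
      by (intro sum_nonneg mult_nonneg_nonneg)
    also have "\<dots> = p i (u / 2 + u / 2)"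
      using coefficient_convolution[where p = p, OF decomposition, of "u / 2" "u / 2" i] Suc.prems by simp
    finally show ?case by simp
  qed
  obtain n where "t / \<epsilon> < 2 ^ n"
    using real_arch_pow[of 2 "t / \<epsilon>"] by auto
  then have "t \<le> 2 ^ n * \<epsilon>"
    using \<open>\<epsilon> > 0\<close> by (simp add: field_simps)
  with \<open>0 \<le> t\<close> show "0 \<le> p j t"
    by (rule doubling)
qed

end
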